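(* $$\lim_{n\to\infty}\frac{|T_{n+1}|}{(n+2)\,|T_n|}=\lim_{n\to\infty}\frac{|\mathcal{IS}_{n+1}|}{(n+2)\,|\mathcal{IS}_n|}=1.$$
   Context: $\mathcal{IS}_n$ is the symmetric inverse semigroup of all partial injective maps from $\{1,\dots,n\}$ to itself (bijections between subsets of $\{1,\dots,n\}$), under composition of partial maps; the empty map, denoted $0$, is its zero element. $T_n\subseteq\mathcal{IS}_n$ is the set of nilpotent elements, i.e. those $\alpha$ with $\alpha^r=0$ for some $r>0$. *)

theory Defs
  imports Complex_Main "HOL-Algebra.Group"
begin

definition partial_injections :: "nat \<Rightarrow> (nat \<rightharpoonup> nat) set" where
  "partial_injections n =
     {\<alpha>. dom \<alpha> \<subseteq> {1..n} \<and> ran \<alpha> \<subseteq> {1..n} \<and> inj_on \<alpha> (dom \<alpha>)}"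

definition sym_inv_semigroup :: "nat \<Rightarrow> (nat \<rightharpoonup> nat) monoid" where
  "sym_inv_semigroup n =
     \<lparr>carrier = partial_injections n, mult = (\<circ>\<^sub>m), one = Some |` {1..n}\<rparr>"

(* The zero element is Map.empty.  The exponent must be positive: for n = 0 the
   identity of the monoid is itself Map.empty. *)
definition nilpotents :: "nat \<Rightarrow> (nat \<rightharpoonup> nat) set" where
  "nilpotents n =
     {\<alpha> \<in> carrier (sym_inv_semigroup n).
        \<exists>r::nat. r > 0 \<and> \<alpha> [^]\<^bsub>sym_inv_semigroup n\<^esub> r = Map.empty}"

lemma partial_injections_alt:
  "\<alpha> \<in> partial_injections n \<longleftrightarrow>
     dom \<alpha> \<subseteq> {1..n} \<and> ran \<alpha> \<subseteq> {1..n} \<and>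
     (\<forall>x y z. \<alpha> x = Some z \<longrightarrow> \<alpha> y = Some z \<longrightarrow> x = y)"
  unfolding partial_injections_def inj_on_def by (auto simp: dom_def)

lemma map_comp_partial_injections:
  assumes "\<alpha> \<in> partial_injections n" "\<beta> \<in> partial_injections n"
  shows "\<alpha> \<circ>\<^sub>m \<beta> \<in> partial_injections n"
proof -
  have "dom (\<alpha> \<circ>\<^sub>m \<beta>) \<subseteq> dom \<beta>" "ran (\<alpha> \<circ>\<^sub>m \<beta>) \<subseteq> ran \<alpha>"
    by (auto simp: map_comp_def ran_def split: option.splits)
  moreover have "x = y" if "(\<alpha> \<circ>\<^sub>m \<beta>) x = Some z" "(\<alpha> \<circ>\<^sub>m \<beta>) y = Some z" for x y z
    using that assms unfolding partial_injections_alt map_comp_Some_iff by metis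
  then have "\<forall>x y z. (\<alpha> \<circ>\<^sub>m \<beta>) x = Some z \<longrightarrow> (\<alpha> \<circ>\<^sub>m \<beta>) y = Some z \<longrightarrow> x = y"
    by blast
  ultimately show ?thesis
    using assms unfolding partial_injections_alt by (meson order_trans)
qed

lemma id_partial_injections: "Some |` {1..n} \<in> partial_injections n"
  by (auto simp: partial_injections_def restrict_map_def ran_def inj_on_def split: if_splits)

lemma monoid_sym_inv_semigroup: "monoid (sym_inv_semigroup n)"
proof (rule monoidI)
  fix x y z
  show "x \<otimes>\<^bsub>sym_inv_semigroup n\<^esub> y \<otimes>\<^bsub>sym_inv_semigroup n\<^esub> z =
        x \<otimes>\<^bsub>sym_inv_semigroup n\<^esub> (y \<otimes>\<^bsub>sym_inv_semigroup n\<^esub> z)"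
    by (auto simp: sym_inv_semigroup_def map_comp_def fun_eq_iff split: option.splits)
next
  fix x assume "x \<in> carrier (sym_inv_semigroup n)"
  then have d: "dom x \<subseteq> {1..n}" and r: "ran x \<subseteq> {1..n}"
    by (auto simp: sym_inv_semigroup_def partial_injections_def)
  have "((Some |` {1..n}) \<circ>\<^sub>m x) a = x a" for a
    using r by (cases "x a") (auto simp: map_comp_def restrict_map_def ran_def)
  then show "\<one>\<^bsub>sym_inv_semigroup n\<^esub> \<otimes>\<^bsub>sym_inv_semigroup n\<^esub> x = x"
    by (simp add: sym_inv_semigroup_def fun_eq_iff)
  have "(x \<circ>\<^sub>m (Some |` {1..n})) a = x a" for a
  proof (cases "a \<in> {1..n}")
    case False
    with d have "x a = None" by (auto simp: dom_def)
    with False show ?thesis by (auto simp: map_comp_def restrict_map_def)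
  qed (auto simp: map_comp_def restrict_map_def)
  then show "x \<otimes>\<^bsub>sym_inv_semigroup n\<^esub> \<one>\<^bsub>sym_inv_semigroup n\<^esub> = x"
    by (simp add: sym_inv_semigroup_def fun_eq_iff)
qed (auto simp: sym_inv_semigroup_def map_comp_partial_injections
      id_partial_injections[simplified])

lemma finite_sym_inv_semigroup: "finite (carrier (sym_inv_semigroup n))"
proof (rule finite_subset)
  show "carrier (sym_inv_semigroup n) \<subseteq>
          (\<Union>D \<in> Pow {1..n}. {\<alpha>. dom \<alpha> = D \<and> ran \<alpha> \<subseteq> {1..n}})"
    by (auto simp: sym_inv_semigroup_def partial_injections_def)
  show "finite (\<Union>D \<in> Pow {1..n}. {\<alpha>::nat \<rightharpoonup> nat. dom \<alpha> = D \<and> ran \<alpha> \<subseteq> {1..n}})"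
    by (auto intro!: finite_set_of_finite_maps intro: finite_subset)
qed

end

theory Submission
  imports Defs "HOL-Real_Asymp.Real_Asymp"
begin

text \<open>
A partial injection of an \<open>n\<close>-element set \<open>V\<close> is a digraph on \<open>V\<close> whose components are
directed cycles and directed paths, and it is nilpotent iff there are no cycles. Let
\<open>k\<close> be the defect of such a graph, that is \<open>n\<close> minus its number of arcs; this is at once the
number of vertices without outgoing arc and of vertices without incoming arc. Let \<open>F\<close>
be the class of all graphs (\<open>e = 0\<close>) or of the acyclic ones (\<open>e = 1\<close>). In either class
the number of ways to add one arc depends only on the defect: it is
\<open>k\<^sup>2 - e k\<close>, because in the acyclic case each of the \<open>k\<close> paths must not be
closed up (\<open>card_free_arcs_acyclic\<close>). Write averages over the
graphs on \<open>V\<close> as \<open>E\<close>. Two counts give everything.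

Every graph with a marked arc arises uniquely by adding that arc to the graph without
it, so \<open>E (n - k) = E (k\<^sup>2 - e k)\<close> (\<open>sum_card_eq_sum_free_arcs\<close>). Hence
\<open>E k\<^sup>2 \<le> n\<close>, and therefore \<open>E k \<le> \<surd>n\<close> (\<open>sum_defect_le\<close>).

A graph on \<open>V\<close> extends to a new vertex \<open>m\<close> by leaving \<open>m\<close> isolated, by a loop at \<open>m\<close> if
\<open>e = 0\<close>, by one arc into or out of \<open>m\<close> (\<open>2 k\<close> ways), or by a detour
\<open>x \<rightarrow> m \<rightarrow> y\<close> replacing an arc \<open>x \<rightarrow> y\<close> that could have been added. On average this is
\<open>2 - e + E (2 k + k\<^sup>2 - e k) = n + 2 - e + E k\<close> ways by the first count
(\<open>card_graphs_insert\<close>).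

So the quotient of consecutive cardinalities lies between \<open>n + 1\<close> and \<open>n + 2 + \<surd>n\<close> for
both classes, and division by \<open>n + 2\<close> gives the limit 1.
\<close>

section \<open>Graphs of partial injections\<close>

definition injection_graphs :: "'a set \<Rightarrow> 'a rel set" where
  "injection_graphs V = {R. R \<subseteq> V \<times> V \<and> single_valued R \<and> single_valued (R\<inverse>)}"

definition defect :: "'a set \<Rightarrow> 'a rel \<Rightarrow> nat" where
  "defect V R = card V - card R"

lemma injection_graphs_subset:
  "S \<in> injection_graphs V \<Longrightarrow> R \<subseteq> S \<Longrightarrow> R \<in> injection_graphs V"
  unfolding injection_graphs_def single_valued_def by blast

lemma finite_injection_graph:
  "finite V \<Longrightarrow> R \<in> injection_graphs V \<Longrightarrow> finite R"
  unfolding injection_graphs_def by (auto intro: finite_subset)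

lemma finite_injection_graphs: "finite V \<Longrightarrow> finite (injection_graphs V)"
  by (rule finite_subset[of _ "Pow (V \<times> V)"]) (auto simp: injection_graphs_def)

text \<open>A new arc fits exactly between a vertex without outgoing arc and a vertex without
incoming arc; this turns the deletion and the addition of an arc into mutually inverse moves.\<close>

lemma insert_injection_graphs_iff:
  assumes "R \<in> injection_graphs V"
  shows "(x, y) \<notin> R \<and> insert (x, y) R \<in> injection_graphs V \<longleftrightarrow>
    x \<in> V - Domain R \<and> y \<in> V - Range R"
proof
  assume "x \<in> V - Domain R \<and> y \<in> V - Range R"
  with assms show "(x, y) \<notin> R \<and> insert (x, y) R \<in> injection_graphs V"
    unfolding injection_graphs_def single_valued_def by auto
next
  assume new: "(x, y) \<notin> R \<and> insert (x, y) R \<in> injection_graphs V"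
  then have "z = y" if "(x, z) \<in> R" for z
    using that unfolding injection_graphs_def single_valued_def by blast
  moreover from new have "z = x" if "(z, y) \<in> R" for z
    using that unfolding injection_graphs_def single_valued_def by blast
  moreover from new have "x \<in> V" "y \<in> V" by (auto simp: injection_graphs_def)
  ultimately show "x \<in> V - Domain R \<and> y \<in> V - Range R" using new by blast
qed

lemma card_injection_graph:
  assumes "finite V" "R \<in> injection_graphs V"
  shows "card (Domain R) = card R" "card (Range R) = card R" "card R \<le> card V"
    "card (V - Domain R) = defect V R" "card (V - Range R) = defect V R"
proof -
  have R: "R \<subseteq> V \<times> V" "single_valued R" "single_valued (R\<inverse>)"
    using assms(2) by (auto simp: injection_graphs_def)
  have "inj_on fst R" "inj_on snd R"
    using R by (auto simp: inj_on_def single_valued_def)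
  then show c: "card (Domain R) = card R" "card (Range R) = card R"
    by (auto simp: Domain_fst Range_snd card_image)
  have s: "Domain R \<subseteq> V" "Range R \<subseteq> V" using R by auto
  show "card R \<le> card V" using card_mono[OF assms(1) s(1)] c by simp
  show "card (V - Domain R) = defect V R" "card (V - Range R) = defect V R"
    using s c assms(1) by (auto simp: defect_def card_Diff_subset finite_subset)
qed

section \<open>Counting by inserting arcs and vertices\<close>

definition free_arcs :: "('a rel \<Rightarrow> bool) \<Rightarrow> 'a set \<Rightarrow> 'a rel \<Rightarrow> 'a rel" where
  "free_arcs P V R =
     {(x, y). x \<in> V - Domain R \<and> y \<in> V - Range R \<and> P (insert (x, y) R)}"

text \<open>The assumptions are what all partial injections and the acyclic ones have in common.
The number \<open>e\<close> tells the two apart: it is 1 if no cycle may be closed, which forbids a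
loop at a new vertex and, for every path, the arc from its end to its start.
\<open>P_detour\<close> says that passing through an otherwise isolated vertex closes a cycle
exactly when the direct arc does.\<close>

locale injection_graph_class =
  fixes P :: "'a rel \<Rightarrow> bool" and e :: nat
  assumes e_le: "e \<le> 1"
    and P_empty: "P {}"
    and P_subset: "P S \<Longrightarrow> R \<subseteq> S \<Longrightarrow> P R"
    and P_source: "P R \<Longrightarrow> m \<notin> Field R \<Longrightarrow> y \<noteq> m \<Longrightarrow> P (insert (m, y) R)"
    and P_sink: "P R \<Longrightarrow> m \<notin> Field R \<Longrightarrow> x \<noteq> m \<Longrightarrow> P (insert (x, m) R)"
    and P_detour: "m \<notin> Field R \<Longrightarrow> x \<noteq> m \<Longrightarrow> y \<noteq> m \<Longrightarrow>
      P (insert (x, m) (insert (m, y) R)) \<longleftrightarrow> P (insert (x, y) R)"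
    and P_loop: "P R \<Longrightarrow> m \<notin> Field R \<Longrightarrow> P (insert (m, m) R) \<longleftrightarrow> e = 0"
    and card_free_arcs: "finite V \<Longrightarrow> R \<in> injection_graphs V \<Longrightarrow> P R \<Longrightarrow>
      card (free_arcs P V R) + e * defect V R = (defect V R)\<^sup>2"
begin

definition graphs :: "'a set \<Rightarrow> 'a rel set" where
  "graphs V = {R \<in> injection_graphs V. P R}"

lemma finite_graphs: "finite V \<Longrightarrow> finite (graphs V)"
  by (simp add: graphs_def finite_injection_graphs)

lemma empty_in_graphs: "{} \<in> graphs V"
  by (simp add: graphs_def injection_graphs_def P_empty)

lemma finite_free_arcs: "finite V \<Longrightarrow> finite (free_arcs P V R)"
  by (rule finite_subset[of _ "V \<times> V"]) (auto simp: free_arcs_def)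

text \<open>Both sides count the pairs of a graph and one of its arcs: the right-hand side counts
them after the marked arc has been deleted.\<close>

lemma sum_card_eq_sum_free_arcs:
  assumes "finite V"
  shows "(\<Sum>R\<in>graphs V. card R) = (\<Sum>R\<in>graphs V. card (free_arcs P V R))"
proof -
  have "bij_betw (\<lambda>(R, a). (R - {a}, a)) (Sigma (graphs V) (\<lambda>R. R))
          (Sigma (graphs V) (free_arcs P V))"
  proof (rule bij_betw_byWitness[where f' = "\<lambda>(R, a). (insert a R, a)"])
    show "(\<lambda>(R, a). (R - {a}, a)) ` Sigma (graphs V) (\<lambda>R. R)
            \<subseteq> Sigma (graphs V) (free_arcs P V)"
    proof safe
      fix R x y assume R: "R \<in> graphs V" and a: "(x, y) \<in> R"
      define Q where "Q = R - {(x, y)}"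
      have RQ: "insert (x, y) Q = R" "Q \<subseteq> R" "(x, y) \<notin> Q"
        using a by (auto simp: Q_def)
      have R': "R \<in> injection_graphs V" "P R" using R by (auto simp: graphs_def)
      have Q: "Q \<in> injection_graphs V" "P Q"
        using injection_graphs_subset[OF R'(1) RQ(2)] P_subset[OF R'(2) RQ(2)] by auto
      then have "Q \<in> graphs V" by (simp add: graphs_def)
      then show "R - {(x, y)} \<in> graphs V" by (simp only: Q_def)
      have "(x, y) \<in> free_arcs P V Q"
        using insert_injection_graphs_iff[OF Q(1), of x y] R' RQ
        by (simp add: free_arcs_def)
      then show "(x, y) \<in> free_arcs P V (R - {(x, y)})" by (simp only: Q_def)
    qed
    have "insert a R \<in> graphs V" if "R \<in> graphs V" "a \<in> free_arcs P V R" for R a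
      using that insert_injection_graphs_iff[of R V "fst a" "snd a"]
      by (cases a) (simp add: graphs_def free_arcs_def)
    then show "(\<lambda>(R, a). (insert a R, a)) ` Sigma (graphs V) (free_arcs P V)
            \<subseteq> Sigma (graphs V) (\<lambda>R. R)" by auto
  next
    show "\<forall>p\<in>Sigma (graphs V) (\<lambda>R. R). (\<lambda>(R, a). (insert a R, a)) ((\<lambda>(R, a). (R - {a}, a)) p) = p"
      by (simp add: split_beta insert_absorb)
    have "a \<notin> R" if "a \<in> free_arcs P V R" for a R
      using that by (cases a) (auto simp: free_arcs_def)
    then show "\<forall>p\<in>Sigma (graphs V) (free_arcs P V).
        (\<lambda>(R, a). (R - {a}, a)) ((\<lambda>(R, a). (insert a R, a)) p) = p"
      by (simp add: split_beta)
  qed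
  then have "card (Sigma (graphs V) (\<lambda>R. R)) = card (Sigma (graphs V) (free_arcs P V))"
    by (rule bij_betw_same_card)
  moreover have "\<forall>R\<in>graphs V. finite R"
    using finite_injection_graph[OF assms] by (auto simp: graphs_def)
  moreover have "\<forall>R\<in>graphs V. finite (free_arcs P V R)"
    using finite_free_arcs[OF assms] by blast
  ultimately show ?thesis
    using finite_graphs[OF assms] by (simp only: card_SigmaI)
qed

text \<open>The sets of arcs by which a new vertex \<open>m\<close> can be joined to \<open>R\<close>. They are listed by shape
(none, loop, out, in, through), rather than described by the property of giving an admissible
graph, so that they can be counted.\<close>

definition attachments :: "'a set \<Rightarrow> 'a \<Rightarrow> 'a rel \<Rightarrow> 'a rel set" where
  "attachments V m R = insert {} (if e = 0 then {{(m, m)}} else {})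
     \<union> (\<lambda>y. {(m, y)}) ` (V - Range R) \<union> (\<lambda>x. {(x, m)}) ` (V - Domain R)
     \<union> (\<lambda>(x, y). {(x, m), (m, y)}) ` free_arcs P V R"

lemma card_attachments:
  assumes V: "finite V" "m \<notin> V" and R: "R \<in> graphs V"
  shows "card (attachments V m R) = 2 - e + 2 * defect V R + card (free_arcs P V R)"
proof -
  define A where "A = insert {} (if e = 0 then {{(m, m)}} else {})"
  define B where "B = (\<lambda>y. {(m, y)}) ` (V - Range R)"
  define C where "C = (\<lambda>x. {(x, m)}) ` (V - Domain R)"
  define D where "D = (\<lambda>(x, y). {(x, m), (m, y)}) ` free_arcs P V R"
  have fin: "finite A" "finite B" "finite C" "finite D"
    using V finite_free_arcs by (auto simp: A_def B_def C_def D_def)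
  have "card A = 2 - e" using e_le by (auto simp: A_def)
  moreover have "card B = defect V R" "card C = defect V R"
    using card_injection_graph[OF V(1)] R
    by (auto simp: B_def C_def graphs_def card_image inj_on_def)
  moreover have "card D = card (free_arcs P V R)"
    unfolding D_def using V(2)
    by (intro card_image) (auto simp: inj_on_def free_arcs_def doubleton_eq_iff)
  moreover have "A \<inter> B = {}" "(A \<union> B) \<inter> C = {}"
    using V(2) by (auto simp: A_def B_def C_def split: if_splits)
  moreover have "(A \<union> B \<union> C) \<inter> D = {}"
    using V(2) by (auto simp: A_def B_def C_def D_def free_arcs_def doubleton_eq_iff split: if_splits)
  ultimately have "card (A \<union> B \<union> C \<union> D) = 2 - e + 2 * defect V R + card (free_arcs P V R)"
    using fin by (simp add: card_Un_disjoint)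
  then show ?thesis by (simp add: attachments_def A_def B_def C_def D_def Un_assoc)
qed

lemma union_attachment_in_graphs:
  assumes V: "m \<notin> V" and R: "R \<in> graphs V" and A: "A \<in> attachments V m R"
  shows "R \<union> A \<in> graphs (insert m V)"
proof -
  have g: "R \<in> injection_graphs V" "P R" using R by (auto simp: graphs_def)
  then have m: "m \<notin> Field R" using V by (auto simp: injection_graphs_def Field_def)
  have neq: "x \<noteq> m" if "x \<in> V" for x using that V by blast
  consider (none) "A = {}" | (loop) "e = 0" "A = {(m, m)}"
    | (out) y where "y \<in> V - Range R" "A = {(m, y)}"
    | (inn) x where "x \<in> V - Domain R" "A = {(x, m)}"
    | (both) x y where "(x, y) \<in> free_arcs P V R" "A = {(x, m), (m, y)}"
    using A by (auto simp: attachments_def split: if_splits)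
  then have "P (R \<union> A)"
  proof cases
    case none
    then show ?thesis using g by simp
  next
    case loop
    then show ?thesis using P_loop[OF g(2) m] by simp
  next
    case out
    then show ?thesis using P_source[OF g(2) m] neq by simp
  next
    case inn
    then show ?thesis using P_sink[OF g(2) m] neq by simp
  next
    case (both x y)
    then show ?thesis using P_detour[OF m, of x y] neq by (simp add: free_arcs_def)
  qed
  moreover have "R \<union> A \<in> injection_graphs (insert m V)"
    using A V g(1) unfolding attachments_def free_arcs_def injection_graphs_def single_valued_def
    by (auto split: if_splits)
  ultimately show ?thesis by (simp add: graphs_def)
qed

text \<open>The list of shapes is complete: at most one arc leaves \<open>m\<close> and at most one
enters it, and the other ends of these arcs were unused in the restriction to \<open>V\<close>.\<close>

lemma new_arcs_in_attachments:
  assumes V: "m \<notin> V" and S: "S \<in> graphs (insert m V)"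
  shows "S - V \<times> V \<in> attachments V m (S \<inter> V \<times> V)"
proof -
  define R where "R = S \<inter> V \<times> V"
  define A where "A = S - V \<times> V"
  have S': "S \<subseteq> insert m V \<times> insert m V" "single_valued S" "single_valued (S\<inverse>)" "P S"
    using S by (auto simp: graphs_def injection_graphs_def)
  have SR: "S = R \<union> A" and m: "m \<notin> Field R"
    using V by (auto simp: R_def A_def Field_def)
  have sv: "\<And>x y z. (x, y) \<in> S \<Longrightarrow> (x, z) \<in> S \<Longrightarrow> y = z"
    and si: "\<And>x y z. (y, x) \<in> S \<Longrightarrow> (z, x) \<in> S \<Longrightarrow> y = z"
    using S'(2,3) by (auto simp: single_valued_def)
  have PR: "P R" using P_subset[OF S'(4)] by (auto simp: R_def)
  have A_arcs: "A = {a. \<exists>y. a = (m, y) \<and> (m, y) \<in> S} \<union> {a. \<exists>x. a = (x, m) \<and> (x, m) \<in> S}"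
    using S'(1) V by (auto simp: A_def)
  have "A \<in> attachments V m R"
  proof (cases "(m, m) \<in> S")
    case True
    then have A: "A = {(m, m)}" using A_arcs sv si by auto
    then have "e = 0" using P_loop[OF PR m] S'(4) by (simp add: SR)
    then show ?thesis unfolding A attachments_def by simp
  next
    case False
    have fy: "y \<in> V - Range R" if "(m, y) \<in> S" for y
    proof -
      have "y \<noteq> m" using that False by blast
      then have "y \<in> V" using that S'(1) by blast
      moreover have "z = m" if "(z, y) \<in> R" for z
        using si[OF \<open>(m, y) \<in> S\<close>, of z] that by (simp add: SR)
      then have "y \<notin> Range R" using m by (auto simp: Field_def)
      ultimately show ?thesis by blast
    qed
    have fx: "x \<in> V - Domain R" if "(x, m) \<in> S" for x
    proof -
      have "x \<noteq> m" using that False by blast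
      then have "x \<in> V" using that S'(1) by blast
      moreover have "z = m" if "(x, z) \<in> R" for z
        using sv[OF \<open>(x, m) \<in> S\<close>, of z] that by (simp add: SR)
      then have "x \<notin> Domain R" using m by (auto simp: Field_def)
      ultimately show ?thesis by blast
    qed
    consider (none) "m \<notin> Domain S" "m \<notin> Range S"
      | (out) y where "(m, y) \<in> S" "m \<notin> Range S"
      | (inn) x where "(x, m) \<in> S" "m \<notin> Domain S"
      | (both) x y where "(x, m) \<in> S" "(m, y) \<in> S" by blast
    then show ?thesis
    proof cases
      case none
      then have "A = {}" using A_arcs by auto
      then show ?thesis by (simp add: attachments_def)
    next
      case (out y)
      then have "A = {(m, y)}" using A_arcs sv by auto
      then show ?thesis using fy[OF out(1)] by (simp add: attachments_def)
    next
      case (inn x)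
      then have "A = {(x, m)}" using A_arcs si by auto
      then show ?thesis using fx[OF inn(1)] by (simp add: attachments_def)
    next
      case (both x y)
      then have A: "A = {(x, m), (m, y)}" using A_arcs sv si by auto
      have "x \<noteq> m" "y \<noteq> m" using both False by auto
      moreover have "P (insert (x, m) (insert (m, y) R))" using S'(4) by (simp add: SR A)
      ultimately have "(x, y) \<in> free_arcs P V R"
        using fx[OF both(1)] fy[OF both(2)] P_detour[OF m] by (simp add: free_arcs_def)
      then show ?thesis by (auto simp: A attachments_def)
    qed
  qed
  then show ?thesis by (simp add: A_def R_def)
qed

text \<open>Splitting a graph on the larger vertex set into its part inside \<open>V\<close> and the arcs at \<open>m\<close>
reduces the count to a sum of numbers of attachments. The number of detours varies with the
graph, but its sum is the sum of the numbers of arcs, and \<open>card R\<close> together with the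
\<open>2 * defect V R\<close> single arcs amounts to \<open>card V + defect V R\<close>.\<close>

lemma card_graphs_insert:
  assumes V: "finite V" "m \<notin> V"
  shows "card (graphs (insert m V)) =
    (card V + 2 - e) * card (graphs V) + (\<Sum>R\<in>graphs V. defect V R)"
proof -
  have "bij_betw (\<lambda>(R, A). R \<union> A) (Sigma (graphs V) (attachments V m)) (graphs (insert m V))"
  proof (rule bij_betw_byWitness[where f' = "\<lambda>S. (S \<inter> V \<times> V, S - V \<times> V)"])
    have "R \<subseteq> V \<times> V" if "R \<in> graphs V" for R
      using that by (auto simp: graphs_def injection_graphs_def)
    moreover have "A \<inter> V \<times> V = {}" if "A \<in> attachments V m R" for A R
      using that V(2) by (auto simp: attachments_def split: if_splits)
    ultimately show "\<forall>p\<in>Sigma (graphs V) (attachments V m).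
        (\<lambda>S. (S \<inter> V \<times> V, S - V \<times> V)) ((\<lambda>(R, A). R \<union> A) p) = p"
      by fastforce
    show "(\<lambda>(R, A). R \<union> A) ` Sigma (graphs V) (attachments V m) \<subseteq> graphs (insert m V)"
      using union_attachment_in_graphs[OF V(2)] by auto
    have "S \<inter> V \<times> V \<in> graphs V" if "S \<in> graphs (insert m V)" for S
      using that P_subset[of S "S \<inter> V \<times> V"]
      by (auto simp: graphs_def injection_graphs_def single_valued_def)
    then show "(\<lambda>S. (S \<inter> V \<times> V, S - V \<times> V)) ` graphs (insert m V)
        \<subseteq> Sigma (graphs V) (attachments V m)"
      using new_arcs_in_attachments[OF V(2)] by auto
  qed auto
  then have "card (graphs (insert m V)) = card (Sigma (graphs V) (attachments V m))"
    by (simp add: bij_betw_same_card)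
  also have "\<dots> = (\<Sum>R\<in>graphs V. card (attachments V m R))"
    using finite_graphs[OF V(1)] V(1) finite_free_arcs
    by (intro card_SigmaI) (auto simp: attachments_def)
  also have "\<dots> = (\<Sum>R\<in>graphs V. 2 - e + 2 * defect V R) + (\<Sum>R\<in>graphs V. card R)"
    using card_attachments[OF V]
    by (simp add: sum_card_eq_sum_free_arcs[OF V(1)] sum.distrib)
  also have "\<dots> = (\<Sum>R\<in>graphs V. (card V + 2 - e) + defect V R)"
    unfolding sum.distrib[symmetric]
  proof (rule sum.cong)
    fix R assume "R \<in> graphs V"
    then have "card R \<le> card V" using card_injection_graph[OF V(1)] by (simp add: graphs_def)
    then show "2 - e + 2 * defect V R + card R = card V + 2 - e + defect V R"
      using e_le by (simp add: defect_def)
  qed simp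
  finally show ?thesis by (simp add: sum.distrib)
qed

text \<open>The double count bounds the mean of the squared defect by \<open>card V\<close>; the mean of the
defect is then at most the square root of that.\<close>

lemma sum_defect_le:
  assumes V: "finite V"
  shows "real (\<Sum>R\<in>graphs V. defect V R) \<le> sqrt (card V) * card (graphs V)"
proof (cases "card V = 0")
  case True
  then show ?thesis by (simp add: defect_def)
next
  case False
  define n where "n = card V"
  have n: "n > 0" using False by (simp add: n_def)
  have "(\<Sum>R\<in>graphs V. (defect V R)\<^sup>2) =
      (\<Sum>R\<in>graphs V. card R) + (\<Sum>R\<in>graphs V. e * defect V R)"
    unfolding sum_card_eq_sum_free_arcs[OF V] sum.distrib[symmetric]
    using card_free_arcs[OF V] by (intro sum.cong) (auto simp: graphs_def)
  also have "\<dots> \<le> (\<Sum>R\<in>graphs V. n)"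
    unfolding sum.distrib[symmetric]
  proof (rule sum_mono)
    fix R assume "R \<in> graphs V"
    then have "card R \<le> card V" using card_injection_graph[OF V(1)] by (simp add: graphs_def)
    moreover have "e * defect V R \<le> defect V R"
      using mult_right_mono[OF e_le, of "defect V R"] by simp
    ultimately show "card R + e * defect V R \<le> n" unfolding defect_def n_def by linarith
  qed
  finally have "real (\<Sum>R\<in>graphs V. (defect V R)\<^sup>2) \<le> real (card (graphs V) * n)"
    by (simp only: of_nat_le_iff sum_constant of_nat_id)
  then have sq: "(\<Sum>R\<in>graphs V. (real (defect V R))\<^sup>2) \<le> n * real (card (graphs V))"
    by (simp add: mult.commute)
  (* The weight sqrt n balances the two terms of the arithmetic-geometric mean inequality
     when the defect equals its upper bound on average. *)
  have "2 * sqrt n * (\<Sum>R\<in>graphs V. real (defect V R)) \<le>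
      (\<Sum>R\<in>graphs V. n + (real (defect V R))\<^sup>2)"
    unfolding sum_distrib_left
  proof (rule sum_mono)
    fix R :: "'a rel"
    show "2 * sqrt n * real (defect V R) \<le> real n + (real (defect V R))\<^sup>2"
      using zero_le_power2[of "sqrt n - real (defect V R)"] by (simp add: power2_diff)
  qed
  also have "\<dots> \<le> 2 * (n * real (card (graphs V)))"
    using sq by (simp add: sum.distrib)
  also have "\<dots> = 2 * sqrt n * (sqrt n * card (graphs V))" by simp
  finally show ?thesis using n by (simp add: n_def)
qed

lemma card_graphs_quotient_tendsto:
  fixes V :: "nat \<Rightarrow> 'a set"
  assumes V: "\<And>n. finite (V n)" "\<And>n. card (V n) = n"
    and new: "\<And>n. m n \<notin> V n" "\<And>n. V (Suc n) = insert (m n) (V n)"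
  shows "(\<lambda>n. real (card (graphs (V (n + 1)))) /
      (real (n + 2) * real (card (graphs (V n))))) \<longlonglongrightarrow> 1"
proof (rule tendsto_sandwich)
  define a where "a n = real (card (graphs (V n)))" for n
  have pos: "a n > 0" for n
    using empty_in_graphs[of "V n"] finite_graphs[OF V(1), of n]
    by (auto simp: a_def card_gt_0_iff)
  have rec: "a (Suc n) = (real n + 2 - real e) * a n + (\<Sum>R\<in>graphs (V n). defect (V n) R)" for n
    using card_graphs_insert[OF V(1) new(1), of n] e_le V(2)[of n]
    by (simp add: a_def new(2) of_nat_diff)
  have lo: "(real n + 1) * a n \<le> a (Suc n)" for n
  proof -
    have "(real n + 1) * a n \<le> (real n + 2 - real e) * a n"
      using e_le pos[of n] by (intro mult_right_mono) auto
    then show ?thesis using rec[of n] by linarith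
  qed
  have hi: "a (Suc n) \<le> (real n + 2 + sqrt n) * a n" for n
  proof -
    have "(real n + 2 - real e) * a n \<le> (real n + 2) * a n"
      using pos[of n] by (intro mult_right_mono) auto
    moreover have "(\<Sum>R\<in>graphs (V n). defect (V n) R) \<le> sqrt n * a n"
      using sum_defect_le[OF V(1), of n] V(2)[of n] by (simp add: a_def)
    ultimately show ?thesis using rec[of n] by (simp add: distrib_right)
  qed
  have quotient: "real (card (graphs (V (n + 1)))) / (real (n + 2) * real (card (graphs (V n))))
      = a (Suc n) / a n / (real n + 2)" for n
    by (simp add: a_def)
  have "real n + 1 \<le> a (Suc n) / a n" "a (Suc n) / a n \<le> real n + 2 + sqrt n" for n
    using lo[of n] hi[of n] pos[of n] by (simp_all add: pos_le_divide_eq pos_divide_le_eq)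
  then show "\<forall>\<^sub>F n in sequentially. (real n + 1) / (real n + 2) \<le>
      real (card (graphs (V (n + 1)))) / (real (n + 2) * real (card (graphs (V n))))"
    and "\<forall>\<^sub>F n in sequentially.
      real (card (graphs (V (n + 1)))) / (real (n + 2) * real (card (graphs (V n))))
      \<le> (real n + 2 + sqrt n) / (real n + 2)"
    unfolding quotient by (intro always_eventually allI divide_right_mono; simp)+
  show "(\<lambda>n. (real n + 1) / (real n + 2)) \<longlonglongrightarrow> 1"
    by real_asymp
  show "(\<lambda>n. (real n + 2 + sqrt n) / (real n + 2)) \<longlonglongrightarrow> 1"
    by real_asymp
qed

end

section \<open>All partial injections, and the acyclic ones\<close>

interpretation all: injection_graph_class "\<lambda>R. True" 0
proof
  fix V :: "'a set" and R
  assume "finite V" "R \<in> injection_graphs V"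
  moreover have "free_arcs (\<lambda>R. True) V R = (V - Domain R) \<times> (V - Range R)"
    by (auto simp: free_arcs_def)
  ultimately show "card (free_arcs (\<lambda>R. True) V R) + 0 * defect V R = (defect V R)\<^sup>2"
    by (simp add: card_cartesian_product card_injection_graph power2_eq_square)
qed auto

lemma rtrancl_sink_unique:
  assumes "single_valued R" "(y, x) \<in> R\<^sup>*" "(y, z) \<in> R\<^sup>*" "x \<notin> Domain R" "z \<notin> Domain R"
  shows "x = z"
  using single_valued_confluent[OF assms(1-3)] assms(4,5)
  by (metis Domain.DomainI converse_rtranclE)

lemma rtrancl_sink_exists:
  assumes "wf (R\<inverse>)"
  shows "\<exists>x. x \<notin> Domain R \<and> (y, x) \<in> R\<^sup>*"
  using assms
proof (induction y)
  case (less y)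
  show ?case
  proof (cases "y \<in> Domain R")
    case True
    then show ?thesis using less by (meson DomainE converse_iff converse_rtrancl_into_rtrancl)
  qed auto
qed

text \<open>Among the \<open>k\<^sup>2\<close> pairs of an unused source and an unused target, an arc \<open>(x, y)\<close>
closes a cycle iff \<open>x\<close> is reachable from \<open>y\<close>. Paths are deterministic, so the only such \<open>x\<close>
is the end of the path that starts at \<open>y\<close>, and exactly \<open>k\<close> pairs are lost.\<close>

lemma card_free_arcs_acyclic:
  assumes V: "finite V" and R: "R \<in> injection_graphs V" and ac: "acyclic R"
  shows "card (free_arcs acyclic V R) + defect V R = (defect V R)\<^sup>2"
proof -
  have R': "R \<subseteq> V \<times> V" "single_valued R" using R by (auto simp: injection_graphs_def)
  have wf: "wf (R\<inverse>)"
    using finite_injection_graph[OF V R] ac by (rule finite_acyclic_wf_converse)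
  define sink where "sink y = (SOME x. x \<notin> Domain R \<and> (y, x) \<in> R\<^sup>*)" for y
  have sink: "sink y \<notin> Domain R" "(y, sink y) \<in> R\<^sup>*" for y
    using someI_ex[OF rtrancl_sink_exists[OF wf, of y]] by (auto simp: sink_def)
  have sink_V: "sink y \<in> V" if "y \<in> V" for y
    using sink(2)[of y] that R'(1) by (metis SigmaE2 rtranclE subsetD)
  have reach: "(y, x) \<in> R\<^sup>* \<longleftrightarrow> x = sink y" if "x \<notin> Domain R" for x y
    using rtrancl_sink_unique[OF R'(2) _ sink(2) that sink(1)] sink(2) by auto
  define B where "B = (\<lambda>y. (sink y, y)) ` (V - Range R)"
  have free: "free_arcs acyclic V R = (V - Domain R) \<times> (V - Range R) - B"
    using ac reach by (auto simp: free_arcs_def B_def)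
  have B: "B \<subseteq> (V - Domain R) \<times> (V - Range R)"
    using sink sink_V by (auto simp: B_def)
  have "card B = defect V R"
    using card_injection_graph[OF V R] by (simp add: B_def card_image inj_on_def)
  then have "card (free_arcs acyclic V R) = defect V R * defect V R - defect V R"
    using B V card_injection_graph[OF V R]
    by (simp add: free card_Diff_subset finite_subset card_cartesian_product)
  then show ?thesis by (simp add: power2_eq_square)
qed

lemma rtrancl_isolated:
  assumes "m \<notin> Field R"
  shows "(m, x) \<in> R\<^sup>* \<longleftrightarrow> x = m" "(x, m) \<in> R\<^sup>* \<longleftrightarrow> x = m"
  using assms by (auto simp: Field_def elim: rtranclE converse_rtranclE)

interpretation acyclic: injection_graph_class acyclic 1
proof
  fix R :: "'a rel" and m x y
  assume m: "m \<notin> Field R" "x \<noteq> m" "y \<noteq> m"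
  show "acyclic (insert (x, m) (insert (m, y) R)) \<longleftrightarrow> acyclic (insert (x, y) R)"
    using m rtrancl_isolated[OF m(1)] by (simp add: rtrancl_insert)
qed (auto simp: rtrancl_isolated card_free_arcs_acyclic wf_acyclic
  intro: acyclic_subset)

section \<open>Nilpotency is acyclicity\<close>

text \<open>In an acyclic finite relation the set of points that start a walk of length \<open>r\<close>
shrinks strictly as \<open>r\<close> grows, until it is empty: a point of it all of whose
successors lie outside starts no longer walk. Conversely, a cycle supports walks of every length.\<close>

lemma acyclic_iff_relpow_empty:
  assumes "finite R"
  shows "acyclic R \<longleftrightarrow> (\<exists>r>0. R ^^ r = {})"
proof
  assume "acyclic R"
  then have wf: "wf (R\<inverse>)" by (rule finite_acyclic_wf_converse[OF assms])
  (* The shift by one is needed because R ^^ 0 is the identity, whose domain may be infinite. *)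
  define D where "D r = Domain (R ^^ Suc r)" for r
  have "D r \<subseteq> Domain R" for r
    unfolding D_def by (blast dest: relpow_Suc_D2)
  then have fin: "finite (D r)" for r
    using assms finite_Domain finite_subset by blast
  obtain r where least: "\<And>k. card (D r) \<le> card (D k)"
    using ex_has_least_nat[of "\<lambda>_. True" 0 "\<lambda>r. card (D r)"] by blast
  have "D r = {}"
  proof (rule ccontr)
    assume "D r \<noteq> {}"
    then obtain x where x: "x \<in> D r" "\<And>z. (x, z) \<in> R \<Longrightarrow> z \<notin> D r"
      using wfE_min[OF wf, of _ "D r"] by (metis converse_iff ex_in_conv)
    have "x \<notin> D (Suc r)"
    proof
      assume "x \<in> D (Suc r)"
      then obtain w where "(x, w) \<in> R ^^ Suc (Suc r)" unfolding D_def by blast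
      then obtain z where "(x, z) \<in> R" "(z, w) \<in> R ^^ Suc r"
        by (meson relpow_Suc_D2)
      then show False using x(2) unfolding D_def by blast
    qed
    moreover have "D (Suc r) \<subseteq> D r" by (auto simp: D_def)
    ultimately have "card (D (Suc r)) < card (D r)"
      using x(1) fin by (intro psubset_card_mono) auto
    with least show False by (simp add: leD)
  qed
  then have "R ^^ Suc r = {}" unfolding D_def by (simp only: Domain_empty_iff)
  then show "\<exists>r>0. R ^^ r = {}" by blast
next
  assume "\<exists>r>0. R ^^ r = {}"
  then obtain r where r: "R ^^ r = {}" by blast
  show "acyclic R"
  proof (rule acyclicI, safe)
    fix x assume x: "(x, x) \<in> R\<^sup>+"
    (* Walk around the cycle: y is the point reached after k steps. *)
    have "\<exists>y. (x, y) \<in> R ^^ k \<and> (y, x) \<in> R\<^sup>+" for k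
    proof (induction k)
      case (Suc k)
      then obtain y where y: "(x, y) \<in> R ^^ k" "(y, x) \<in> R\<^sup>+" by blast
      from y(2) obtain z where "(y, z) \<in> R" "(z, x) \<in> R\<^sup>*" by (meson tranclD)
      then show ?case using y(1) x by (meson relpow_Suc_I rtrancl_trancl_trancl)
    qed (use x in auto)
    with r show False by blast
  qed
qed

text \<open>The statement is for positive exponents only: the zeroth power of \<open>\<alpha>\<close> is the identity of
\<open>{1..n}\<close>, whereas the zeroth power of its graph is the identity of the whole type.\<close>

lemma graph_pow:
  assumes "\<alpha> \<in> partial_injections n"
  shows "Map.graph (\<alpha> [^]\<^bsub>sym_inv_semigroup n\<^esub> Suc r) = Map.graph \<alpha> ^^ Suc r"
proof (induction r)
  case 0
  interpret monoid "sym_inv_semigroup n" by (rule monoid_sym_inv_semigroup)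
  have "\<alpha> \<in> carrier (sym_inv_semigroup n)" using assms by (simp add: sym_inv_semigroup_def)
  then show ?case by simp
next
  case (Suc r)
  have "\<alpha> [^]\<^bsub>sym_inv_semigroup n\<^esub> Suc (Suc r) =
      (\<alpha> [^]\<^bsub>sym_inv_semigroup n\<^esub> Suc r) \<circ>\<^sub>m \<alpha>"
    by (simp only: nat_pow_Suc) (simp add: sym_inv_semigroup_def)
  then show ?case
    using Suc.IH by (simp only: Map.graph_map_comp) (metis relpow.simps(2) relpow_commute)
qed

lemma graph_empty_iff: "Map.graph \<alpha> = {} \<longleftrightarrow> \<alpha> = Map.empty"
  by (auto simp: Map.graph_def fun_eq_iff)

lemma bij_betw_graph:
  "bij_betw Map.graph (partial_injections n) (injection_graphs {1..n})"
proof -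
  define g :: "nat rel \<Rightarrow> nat \<rightharpoonup> nat" where
    "g R x = (if x \<in> Domain R then Some (THE y. (x, y) \<in> R) else None)" for R x
  have g_graph: "g (Map.graph \<alpha>) = \<alpha>" for \<alpha>
    by (auto simp: g_def Map.graph_def fun_eq_iff)
  have "(THE y. (x, y) \<in> R) = y" if "single_valued R" "(x, y) \<in> R" for R and x y :: nat
    using that by (auto simp: single_valued_def)
  then have graph_g: "Map.graph (g R) = R" if "R \<in> injection_graphs {1..n}" for R
    using that by (auto simp: g_def Map.graph_def injection_graphs_def split: if_splits)
  have in_iff: "\<alpha> \<in> partial_injections n \<longleftrightarrow> Map.graph \<alpha> \<in> injection_graphs {1..n}" for \<alpha>
  proof -
    have "Map.graph \<alpha> \<subseteq> V \<times> V \<longleftrightarrow> dom \<alpha> \<subseteq> V \<and> ran \<alpha> \<subseteq> V" for V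
      unfolding Map.graph_def dom_def ran_def by blast
    moreover have "single_valued (Map.graph \<alpha>)"
      by (simp add: single_valued_def Map.graph_def)
    moreover have "single_valued ((Map.graph \<alpha>)\<inverse>) \<longleftrightarrow>
        (\<forall>x y z. \<alpha> x = Some z \<longrightarrow> \<alpha> y = Some z \<longrightarrow> x = y)"
      unfolding single_valued_def Map.graph_def by auto
    ultimately show ?thesis
      unfolding partial_injections_alt injection_graphs_def by (simp only: mem_Collect_eq simp_thms conj_assoc)
  qed
  show ?thesis
    by (rule bij_betw_byWitness[where f' = g]) (auto simp: g_graph graph_g in_iff simp del: One_nat_def)
qed

lemma card_partial_injections:
  "card (carrier (sym_inv_semigroup n)) = card (all.graphs {1..n})"
  using bij_betw_same_card[OF bij_betw_graph]
  by (simp add: sym_inv_semigroup_def all.graphs_def)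

lemma nilpotent_iff_acyclic:
  assumes "\<alpha> \<in> partial_injections n"
  shows "\<alpha> \<in> nilpotents n \<longleftrightarrow> acyclic (Map.graph \<alpha>)"
proof -
  have pow_empty: "Map.graph \<alpha> ^^ r = {} \<longleftrightarrow> \<alpha> [^]\<^bsub>sym_inv_semigroup n\<^esub> r = Map.empty"
    if "r > 0" for r :: nat
  proof -
    have "Map.graph \<alpha> ^^ r = Map.graph (\<alpha> [^]\<^bsub>sym_inv_semigroup n\<^esub> r)"
      using graph_pow[OF assms, of "r - 1"] that by simp
    then show ?thesis by (simp only: graph_empty_iff)
  qed
  have "finite (Map.graph \<alpha>)"
    using bij_betwE[OF bij_betw_graph] assms finite_injection_graph[of "{1..n}"] by blast
  then have "acyclic (Map.graph \<alpha>) \<longleftrightarrow> (\<exists>r>0. Map.graph \<alpha> ^^ r = {})"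
    by (rule acyclic_iff_relpow_empty)
  also have "\<dots> \<longleftrightarrow> (\<exists>r>0. \<alpha> [^]\<^bsub>sym_inv_semigroup n\<^esub> (r::nat) = Map.empty)"
    using pow_empty by blast
  finally show ?thesis using assms by (simp add: nilpotents_def sym_inv_semigroup_def)
qed

lemma card_nilpotents: "card (nilpotents n) = card (acyclic.graphs {1..n})"
proof -
  have sub: "nilpotents n \<subseteq> partial_injections n"
    by (auto simp: nilpotents_def sym_inv_semigroup_def)
  have "Map.graph ` nilpotents n = acyclic.graphs {1..n}"
  proof
    show "Map.graph ` nilpotents n \<subseteq> acyclic.graphs {1..n}"
      using sub nilpotent_iff_acyclic bij_betwE[OF bij_betw_graph, of n]
      by (auto simp: acyclic.graphs_def simp del: One_nat_def)
    show "acyclic.graphs {1..n} \<subseteq> Map.graph ` nilpotents n"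
    proof
      fix R assume R: "R \<in> acyclic.graphs {1..n}"
      then have "R \<in> Map.graph ` partial_injections n"
        using bij_betw_imp_surj_on[OF bij_betw_graph, of n] by (simp only: acyclic.graphs_def mem_Collect_eq)
      then obtain \<alpha> where "\<alpha> \<in> partial_injections n" "R = Map.graph \<alpha>" by blast
      with R show "R \<in> Map.graph ` nilpotents n"
        by (auto simp: acyclic.graphs_def nilpotent_iff_acyclic)
    qed
  qed
  then have "bij_betw Map.graph (nilpotents n) (acyclic.graphs {1..n})"
    by (rule bij_betw_subset[OF bij_betw_graph sub])
  then show ?thesis by (rule bij_betw_same_card)
qed

theorem theorem8:
  "((\<lambda>n. real (card (nilpotents (n + 1))) /
         (real (n + 2) * real (card (nilpotents n)))) \<longlonglongrightarrow> 1) \<and>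
   ((\<lambda>n. real (card (carrier (sym_inv_semigroup (n + 1)))) /
         (real (n + 2) * real (card (carrier (sym_inv_semigroup n))))) \<longlonglongrightarrow> 1)"
proof -
  have "{1..Suc n} = insert (Suc n) {1..n}" for n by auto
  then show ?thesis
    using acyclic.card_graphs_quotient_tendsto[of "\<lambda>n. {1..n}" Suc]
      all.card_graphs_quotient_tendsto[of "\<lambda>n. {1..n}" Suc]
    unfolding card_nilpotents card_partial_injections by simp
qed

end
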